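(* Let $p_i$ denote the $i$-th prime ($p_1=2$). For $n\ge 1$ let $Q_n=2\prod_{i=1}^n p_i$, and let $w_n=aabb(ab)^{(Q_n-4)/2}$, a word over $\{a,b\}$ of length $Q_n$. Then for all $n\ge 2$, the word $w_n$ has $n$ distinct A-primitive roots. In particular, for every $1\le m\le n$ the word $r_m=aabb(ab)^{p_m-2}$ is an A-primitive root of $w_n$.
   Context: The Parikh vector of $w\in\{a,b\}^*$ is $\Psi(w)=(|w|_a,|w|_b)$, the vector of numbers of occurrences of each letter. A word $w$ is a $k$-th Abelian power if $w=u_1u_2\cdots u_k$ with $\Psi(u_i)=\Psi(u_j)$ for all $1\le i,j\le k$. A word is A-primitive if it is not a $k$-th Abelian power for any $k\ge 2$. If $w$ is an Abelian power, a word $u$ is an A-root of $w$ if $w=u\,u_1u_2\cdots u_\ell$ for some $\ell\ge1$ and words $u_1,\dots,u_\ell$ with $\Psi(u)=\Psi(u_i)$ for all $i$. An A-primitive root of $w$ is an A-root of $w$ that is A-primitive. Two A-primitive roots $u,v$ of $w$ are called distinct if $|u|$ does not divide $|v|$ and $|v|$ does not divide $|u|$; "$n$ distinct roots" means $n$ pairwise distinct ones in this sense. *)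

theory Defs
  imports "HOL-Computational_Algebra.Primes" "HOL-Library.Infinite_Set"
begin

datatype letter = La | Lb

type_synonym word = "letter list"

definition parikh :: "word \<Rightarrow> nat \<times> nat" where
  "parikh w = (count_list w La, count_list w Lb)"

definition kth_abelian_power :: "nat \<Rightarrow> word \<Rightarrow> bool" where
  "kth_abelian_power k w \<longleftrightarrow>
     (\<exists>us. length us = k \<and> w = concat us \<and>
        (\<forall>i<k. \<forall>j<k. parikh (us ! i) = parikh (us ! j)))"

definition abelian_power :: "word \<Rightarrow> bool" where
  "abelian_power w \<longleftrightarrow> (\<exists>k\<ge>2. kth_abelian_power k w)"

definition A_primitive :: "word \<Rightarrow> bool" where
  "A_primitive w \<longleftrightarrow> \<not> (\<exists>k\<ge>2. kth_abelian_power k w)"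

definition A_root :: "word \<Rightarrow> word \<Rightarrow> bool" where
  "A_root u w \<longleftrightarrow> abelian_power w \<and>
     (\<exists>us. length us \<ge> 1 \<and> w = u @ concat us \<and> (\<forall>v\<in>set us. parikh u = parikh v))"

definition A_primitive_root :: "word \<Rightarrow> word \<Rightarrow> bool" where
  "A_primitive_root u w \<longleftrightarrow> A_root u w \<and> A_primitive u"

definition distinct_roots :: "word \<Rightarrow> word \<Rightarrow> bool" where
  "distinct_roots u v \<longleftrightarrow> \<not> length u dvd length v \<and> \<not> length v dvd length u"

definition has_n_distinct_A_primitive_roots :: "nat \<Rightarrow> word \<Rightarrow> bool" where
  "has_n_distinct_A_primitive_roots n w \<longleftrightarrow>
     (\<exists>S. finite S \<and> card S = n \<and> (\<forall>u\<in>S. A_primitive_root u w) \<and> pairwise distinct_roots S)"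

(* Primes are indexed from 1, whereas enumerate counts from 0; the index 0 is never used. *)
definition nth_prime :: "nat \<Rightarrow> nat" where
  "nth_prime i = enumerate {p::nat. prime p} (i - 1)"

definition word_pow :: "word \<Rightarrow> nat \<Rightarrow> word" where
  "word_pow u k = concat (replicate k u)"

definition Q :: "nat \<Rightarrow> nat" where
  "Q n = 2 * (\<Prod>i=1..n. nth_prime i)"

(* The truncating subtraction and the division are exact for n >= 1; see length_w_word. *)
definition w_word :: "nat \<Rightarrow> word" where
  "w_word n = [La, La, Lb, Lb] @ word_pow [La, Lb] ((Q n - 4) div 2)"

definition r_word :: "nat \<Rightarrow> word" where
  "r_word m = [La, La, Lb, Lb] @ word_pow [La, Lb] (nth_prime m - 2)"

lemma prime_nth_prime: "prime (nth_prime i)"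
  using enumerate_in_set[OF primes_infinite] unfolding nth_prime_def by blast

lemma nth_prime_1: "nth_prime 1 = 2"
  unfolding nth_prime_def enumerate_0 diff_self_eq_0
  by (rule Least_equality) (auto dest: prime_ge_2_nat)

lemma length_w_word:
  assumes "n \<ge> 1"
  shows "length (w_word n) = Q n"
proof -
  have "(\<Prod>i=1..n. nth_prime i) = nth_prime 1 * (\<Prod>i=2..n. nth_prime i)"
    using assms by (simp add: prod.atLeast_Suc_atMost numeral_2_eq_2)
  then have "Q n = 4 * (\<Prod>i=2..n. nth_prime i)"
    unfolding Q_def nth_prime_1 by linarith
  moreover have "(\<Prod>i=2..n. nth_prime i) > 0"
    by (intro prod_pos) (simp add: prime_gt_0_nat prime_nth_prime)
  ultimately have "Q n \<ge> 4 \<and> even (Q n)"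
    by (metis One_nat_def Suc_leI dvd_mult2 even_numeral mult.right_neutral mult_le_mono2)
  moreover have "length (word_pow u k) = k * length u" for u k
    by (induction k) (auto simp: word_pow_def)
  ultimately show ?thesis
    by (auto simp: w_word_def mult_2_right[symmetric])
qed

end

theory Submission
  imports Defs
begin

text \<open>
  Write \<open>P\<close> for the product of the first \<open>n\<close> primes, so that \<open>w\<^sub>n = aabb(ab)\<^bsup>P-2\<^esup>\<close>. For each prime
  \<open>p dvd P\<close>, cutting \<open>w\<^sub>n\<close> into blocks of length \<open>2p\<close> gives \<open>aabb(ab)\<^bsup>p-2\<^esup>\<close> followed by copies of
  \<open>(ab)\<^sup>p\<close>, all with Parikh vector \<open>(p, p)\<close>. Decomposing the first block into \<open>k \<ge> 2\<close> blocks with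
  equal Parikh vectors forces \<open>k dvd p\<close>, hence \<open>k = p\<close> and blocks with Parikh vector \<open>(1, 1)\<close>, but
  the first of them is \<open>aa\<close>.
\<close>

text \<open>One family for both words: \<open>r_word m\<close> is its member at a prime and
  \<open>w_word n\<close> its member at a product of primes, so rootness reduces to divisibility of
  parameters.\<close>

definition aabb_word :: "nat \<Rightarrow> word" where
  "aabb_word p = [La, La, Lb, Lb] @ word_pow [La, Lb] (p - 2)"

lemma r_word_eq_aabb_word: "r_word m = aabb_word (nth_prime m)"
  by (simp add: r_word_def aabb_word_def)

lemma w_word_eq_aabb_word: "w_word n = aabb_word (\<Prod>i=1..n. nth_prime i)"
proof -
  have "(2 * P - 4) div 2 = P - 2" for P :: nat
    by linarith
  then show ?thesis
    by (simp only: w_word_def aabb_word_def Q_def)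
qed

lemma word_pow_add: "word_pow u (j + k) = word_pow u j @ word_pow u k"
  by (simp add: word_pow_def replicate_add)

lemma word_pow_mult: "word_pow u (j * k) = concat (replicate k (word_pow u j))"
  by (induction k) (simp_all add: word_pow_add, simp add: word_pow_def)

lemma parikh_word_pow_ab: "parikh (word_pow [La, Lb] k) = (k, k)"
  by (induction k) (simp_all add: word_pow_def parikh_def)

lemma parikh_aabb_word:
  assumes "p \<ge> 2"
  shows "parikh (aabb_word p) = (p, p)"
  using assms parikh_word_pow_ab[of "p - 2"] by (simp add: aabb_word_def parikh_def)

lemma length_eq_sum_parikh: "length w = fst (parikh w) + snd (parikh w)"
proof (induction w)
  case (Cons x w)
  then show ?case by (cases x) (simp_all add: parikh_def)
qed (simp add: parikh_def)

lemma length_aabb_word: "p \<ge> 2 \<Longrightarrow> length (aabb_word p) = 2 * p"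
  by (simp add: length_eq_sum_parikh parikh_aabb_word)

lemma parikh_concat:
  assumes "\<forall>u\<in>set us. parikh u = (a, b)"
  shows "parikh (concat us) = (length us * a, length us * b)"
  using assms by (induction us) (simp_all add: parikh_def)

lemma A_primitive_aabb_word:
  assumes "prime p"
  shows "A_primitive (aabb_word p)"
  unfolding A_primitive_def
proof
  assume "\<exists>k\<ge>2. kth_abelian_power k (aabb_word p)"
  then obtain us where len: "length us \<ge> 2" and concat: "aabb_word p = concat us"
    and eq: "\<forall>i<length us. \<forall>j<length us. parikh (us ! i) = parikh (us ! j)"
    unfolding kth_abelian_power_def by auto
  obtain u vs where us: "us = u # vs"
    using len by (cases us) auto
  obtain a b where ab: "parikh u = (a, b)"
    by fastforce
  have "\<forall>v\<in>set us. parikh v = (a, b)"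
    using eq ab us by (metis in_set_conv_nth length_greater_0_conv list.discI nth_Cons_0)
  then have "parikh (aabb_word p) = (length us * a, length us * b)"
    unfolding concat by (rule parikh_concat)
  then have p: "p = length us * a" "p = length us * b"
    using parikh_aabb_word[OF prime_ge_2_nat[OF assms]] by (metis prod.inject)+
  then have "length us = p"
    using len assms by (metis dvd_triv_left One_nat_def Suc_1 not_less_eq_eq order_refl prime_nat_iff)
  \<comment> \<open>Cancelling \<open>p\<close> in \<open>p = p * a\<close> and
    \<open>p = p * b\<close> leaves \<open>a = b = 1\<close>.\<close>
  then have "parikh u = (1, 1)"
    using p ab prime_gt_0_nat[OF assms] by auto
  then have "length u = 2"
    by (simp add: length_eq_sum_parikh)
  then have "u = take 2 (aabb_word p)"
    by (simp add: concat us)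
  then have "u = [La, La]"
    by (simp add: aabb_word_def)
  with \<open>parikh u = (1, 1)\<close> show False
    by (simp add: parikh_def)
qed

lemma A_root_aabb_word_mult:
  assumes "p \<ge> 2" "l \<ge> 2"
  shows "A_root (aabb_word p) (aabb_word (p * l))"
proof -
  define vs where "vs = replicate (l - 1) (word_pow [La, Lb] p)"
  \<comment> \<open>The first \<open>p - 2\<close> copies of \<open>ab\<close> complete the block
    \<open>aabb_word p\<close>; the others form \<open>l - 1\<close> blocks. No subtraction
    truncates, as \<open>p\<close> and \<open>l\<close> are at least 2.\<close>
  have "p * l - 2 = (p - 2) + p * (l - 1)"
    using assms by (cases l) auto
  then have decomp: "aabb_word (p * l) = aabb_word p @ concat vs"
    by (simp add: aabb_word_def vs_def word_pow_add word_pow_mult)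
  have vs: "\<forall>v\<in>set vs. parikh v = (p, p)" and u: "parikh (aabb_word p) = (p, p)"
    using assms(1) by (simp_all add: vs_def parikh_word_pow_ab parikh_aabb_word)
  \<comment> \<open>\<open>A_root\<close> also requires the whole word to be an Abelian power; the
    same \<open>l\<close> blocks witness this.\<close>
  have "length (aabb_word p # vs) = l"
    using assms(2) by (simp add: vs_def)
  moreover have "\<forall>i<length (aabb_word p # vs). parikh ((aabb_word p # vs) ! i) = (p, p)"
    using vs u nth_mem[of _ "aabb_word p # vs"] by fastforce
  ultimately have "kth_abelian_power l (aabb_word (p * l))"
    unfolding kth_abelian_power_def
    using decomp by (intro exI[of _ "aabb_word p # vs"]) simp
  then show ?thesis
    using assms decomp vs u unfolding A_root_def abelian_power_def
    by (auto intro!: exI[of _ vs] simp: vs_def)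
qed

lemma A_primitive_root_r_word:
  assumes "n \<ge> 2" "1 \<le> m" "m \<le> n"
  shows "A_primitive_root (r_word m) (w_word n)"
proof -
  define l where "l = (\<Prod>i\<in>{1..n} - {m}. nth_prime i)"
  have "(\<Prod>i=1..n. nth_prime i) = nth_prime m * l"
    using assms by (simp add: l_def prod.remove)
  moreover have "l \<ge> 2"
  proof -
    \<comment> \<open>Here \<open>n \<ge> 2\<close> matters: another index remains, so the cofactor
      \<open>l\<close> has a prime divisor.\<close>
    obtain j where j: "j \<in> {1..n} - {m}"
      using assms that[of "if m = 1 then 2 else 1"] by auto
    then have "nth_prime j dvd l"
      by (simp add: l_def dvd_prodI)
    moreover have "l > 0"
      by (simp add: l_def prime_gt_0_nat prime_nth_prime prod_pos)
    ultimately show ?thesis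
      using prime_ge_2_nat[OF prime_nth_prime] dvd_imp_le le_trans by blast
  qed
  ultimately show ?thesis
    using prime_nth_prime[of m]
    by (simp add: A_primitive_root_def r_word_eq_aabb_word w_word_eq_aabb_word
        A_root_aabb_word_mult A_primitive_aabb_word prime_ge_2_nat)
qed

text \<open>Enumerating an infinite set is strictly increasing. The bounds exclude index 0, which
  truncation in \<open>i - 1\<close> would identify with index 1.\<close>

lemma nth_prime_eq_iff:
  assumes "i \<ge> 1" "j \<ge> 1"
  shows "nth_prime i = nth_prime j \<longleftrightarrow> i = j"
proof -
  have "inj (enumerate {p::nat. prime p})"
    by (intro strict_mono_imp_inj_on strict_mono_enumerate primes_infinite)
  then show ?thesis
    using assms by (auto simp: nth_prime_def inj_eq)
qed

lemma length_r_word: "length (r_word m) = 2 * nth_prime m"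
  by (simp add: r_word_eq_aabb_word length_aabb_word prime_ge_2_nat prime_nth_prime)

text \<open>The lengths are twice two different primes, neither of which divides the other.\<close>

lemma distinct_roots_r_word:
  assumes "i \<ge> 1" "j \<ge> 1" "i \<noteq> j"
  shows "distinct_roots (r_word i) (r_word j)"
  using assms nth_prime_eq_iff[of i j] primes_dvd_imp_eq[of "nth_prime i" "nth_prime j"]
    primes_dvd_imp_eq[of "nth_prime j" "nth_prime i"]
  by (auto simp: distinct_roots_def length_r_word prime_nth_prime)

theorem lemma1:
  fixes n :: nat
  assumes "n \<ge> 2"
  shows "has_n_distinct_A_primitive_roots n (w_word n) \<and>
         (\<forall>m. 1 \<le> m \<and> m \<le> n \<longrightarrow> A_primitive_root (r_word m) (w_word n))"
proof
  show roots: "\<forall>m. 1 \<le> m \<and> m \<le> n \<longrightarrow> A_primitive_root (r_word m) (w_word n)"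
    using assms A_primitive_root_r_word by blast
  \<comment> \<open>Injectivity makes the set of roots have exactly \<open>n\<close> elements; the
    length of \<open>r_word i\<close> determines \<open>i\<close>.\<close>
  have "inj_on r_word {1..n}"
  proof (rule inj_onI)
    fix i j
    assume "i \<in> {1..n}" "j \<in> {1..n}" "r_word i = r_word j"
    then show "i = j"
      using nth_prime_eq_iff length_r_word
      by (metis atLeastAtMost_iff mult_left_cancel zero_neq_numeral)
  qed
  then have "card (r_word ` {1..n}) = n"
    by (simp add: card_image)
  moreover have "pairwise distinct_roots (r_word ` {1..n})"
    by (auto simp: pairwise_def intro!: distinct_roots_r_word)
  ultimately show "has_n_distinct_A_primitive_roots n (w_word n)"
    unfolding has_n_distinct_A_primitive_roots_def using roots
    by (intro exI[of _ "r_word ` {1..n}"]) auto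
qed

end
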